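(* For sufficiently small constant $\epsilon>0$, $\mathrm{instopt}(D_{r,d},\epsilon,1/10)=\Omega(d)$ bits in the insertion-only streaming model.
   Context: The heavy edges graph $D_{r,d}$ consists of $r$ disjoint copies of the following graph: $d$ disjoint edges $u_{2i}u_{2i+1}$, $i=0,\dots,d-1$, one of which has both endpoints connected to each of $d$ further vertices $v_0,\dots,v_{d-1}$. In the insertion-only model the edges of the input graph arrive in arbitrary order and are never deleted; cost is space in bits. An algorithm solves $G$ with $S$ space and $(\epsilon,\delta)$ error if, for every graph $G'$ isomorphic to some subgraph of $G$, given $G'$ as input it returns a value in $T(G')\pm\epsilon T(G)$ with probability at least $1-\delta$ using at most $S$ space, where $T(H)$ denotes the number of triangles of $H$. $\mathrm{instopt}(G,\epsilon,\delta)$ is the least $S$ such that some algorithm solves $G$ with $S$ space and $(\epsilon,\delta)$ error. *)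

theory Defs
  imports "HOL-Probability.Probability_Mass_Function"
begin

record 'a graph =
  verts :: "'a set"
  edges :: "'a set set"

definition simple_graph :: "'a graph \<Rightarrow> bool" where
  "simple_graph G \<longleftrightarrow>
     finite (verts G) \<and> (\<forall>e\<in>edges G. e \<subseteq> verts G \<and> card e = 2)"

definition subgraph :: "'a graph \<Rightarrow> 'a graph \<Rightarrow> bool" where
  "subgraph H G \<longleftrightarrow>
     simple_graph H \<and> simple_graph G \<and> verts H \<subseteq> verts G \<and> edges H \<subseteq> edges G"

definition isomorphic :: "'a graph \<Rightarrow> 'b graph \<Rightarrow> bool" where
  "isomorphic G H \<longleftrightarrow>
     simple_graph G \<and> simple_graph H \<and>
     (\<exists>f. bij_betw f (verts G) (verts H) \<and> edges H = (\<lambda>e. f ` e) ` edges G)"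

definition triangles :: "'a graph \<Rightarrow> 'a set set" where
  "triangles G =
     {t. t \<subseteq> verts G \<and> card t = 3 \<and> (\<forall>x\<in>t. \<forall>y\<in>t. x \<noteq> y \<longrightarrow> {x, y} \<in> edges G)}"

definition num_triangles :: "'a graph \<Rightarrow> nat" where
  "num_triangles G = card (triangles G)"

datatype heavy_vertex = U nat | V nat

text \<open>The vertex \<open>(k, U j)\<close> is \<open>u\<^sub>j\<close> of the \<open>k\<close>-th copy and \<open>(k, V j)\<close> is \<open>v\<^sub>j\<close> of the
  \<open>k\<close>-th copy. The edge joined to all the \<open>v\<^sub>j\<close> is taken to be \<open>u\<^sub>0u\<^sub>1\<close>. Meaningful for \<open>d \<ge> 1\<close>.\<close>

definition heavy_edges_graph :: "nat \<Rightarrow> nat \<Rightarrow> (nat \<times> heavy_vertex) graph" where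
  "heavy_edges_graph r d =
     \<lparr>verts = {(k, U j) | k j. k < r \<and> j < 2 * d} \<union> {(k, V j) | k j. k < r \<and> j < d},
      edges = {{(k, U (2 * i)), (k, U (2 * i + 1))} | k i. k < r \<and> i < d}
            \<union> {{(k, U a), (k, V j)} | k a j. k < r \<and> a \<in> {0, 1} \<and> j < d}\<rparr>"

text \<open>A randomised streaming algorithm over edges with vertex names in \<open>nat\<close>. Between stream
  elements it keeps only a bit string; fresh coins may be tossed initially, at every update and
  when producing the output. Neither running time nor the working space inside a single update is
  charged, so that lower bounds in this model carry over to more restrictive ones.\<close>

record stream_alg =
  init :: "bool list pmf"
  update :: "nat set \<Rightarrow> bool list \<Rightarrow> bool list pmf"
  result :: "bool list \<Rightarrow> real pmf"

definition memory_after :: "stream_alg \<Rightarrow> nat set list \<Rightarrow> bool list pmf" where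
  "memory_after A xs = foldl (\<lambda>M e. bind_pmf M (update A e)) (init A) xs"

definition alg_output :: "stream_alg \<Rightarrow> nat set list \<Rightarrow> real pmf" where
  "alg_output A xs = bind_pmf (memory_after A xs) (result A)"

definition uses_space :: "stream_alg \<Rightarrow> nat set list \<Rightarrow> nat \<Rightarrow> bool" where
  "uses_space A xs S \<longleftrightarrow>
     (\<forall>k\<le>length xs. \<forall>m\<in>set_pmf (memory_after A (take k xs)). length m \<le> S)"

definition insertion_stream :: "'a graph \<Rightarrow> 'a set list \<Rightarrow> bool" where
  "insertion_stream G xs \<longleftrightarrow> distinct xs \<and> set xs = edges G"

text \<open>Input graphs have vertex names in \<open>{..<N}\<close>. Over an infinite name universe a lower
  bound could hold merely because unboundedly many names cannot be told apart in bounded memory.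
  The condition \<open>N \<ge> card (verts G)\<close> ensures that every isomorphism
  type of a subgraph of \<open>G\<close> occurs under all its labellings by these names. The algorithm may
  depend on \<open>N\<close> and \<open>G\<close>.\<close>

definition solves ::
  "stream_alg \<Rightarrow> nat \<Rightarrow> 'a graph \<Rightarrow> nat \<Rightarrow> real \<Rightarrow> real \<Rightarrow> bool" where
  "solves A N G S \<epsilon> \<delta> \<longleftrightarrow>
     (\<forall>G'. verts G' \<subseteq> {..<N} \<and> (\<exists>H. subgraph H G \<and> isomorphic G' H) \<longrightarrow>
       (\<forall>xs. insertion_stream G' xs \<longrightarrow>
          uses_space A xs S \<and>
          measure_pmf.prob (alg_output A xs)
            {y. \<bar>y - real (num_triangles G')\<bar> \<le> \<epsilon> * real (num_triangles G)} \<ge> 1 - \<delta>))"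

definition instopt :: "nat \<Rightarrow> 'a graph \<Rightarrow> real \<Rightarrow> real \<Rightarrow> nat" where
  "instopt N G \<epsilon> \<delta> = (LEAST S. \<exists>A. solves A N G S \<epsilon> \<delta>)"

end

theory Submission
  imports Defs
begin

text \<open>Reduction from the one-way communication problem INDEX. The sender, holding \<open>X \<subseteq> {..<d}\<close>,
  streams in every copy the edges \<open>u\<^sub>2\<^sub>ju\<^sub>2\<^sub>j\<^sub>+\<^sub>1\<close> with \<open>j \<in> X\<close>; the receiver, holding \<open>i\<close>, then
  joins \<open>u\<^sub>2\<^sub>i\<close> and \<open>u\<^sub>2\<^sub>i\<^sub>+\<^sub>1\<close> to all \<open>v\<^sub>j\<close>. The result is, up to relabelling, a subgraph of the heavy
  edges graph, and it has \<open>rd\<close> triangles if \<open>i \<in> X\<close> and none otherwise, so an estimate to within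
  \<open>rd/4\<close> reveals whether \<open>i \<in> X\<close>. Hence the memory passed from sender to receiver solves INDEX.\<close>

section \<open>The INDEX problem\<close>

text \<open>A Chernoff bound: weighting each subset \<open>Y\<close> by
  \<open>(1/4) ^ card Y\<close> gives total weight \<open>(5/4) ^ d\<close>, and each small subset
  weighs at least \<open>(1/4) ^ (d div 5)\<close>. The fifth power keeps all exponents integral;
  the bound amounts to \<open>2 ^ (4d/5)\<close> small subsets.\<close>

lemma small_subsets_card_power5:
  fixes D :: "'a set"
  assumes "finite D"
  shows "card {Y \<in> Pow D. 5 * card Y \<le> card D} ^ 5 \<le> 16 ^ card D"
proof -
  define d where "d = card D"
  define B where "B = {Y \<in> Pow D. 5 * card Y \<le> d}"
  define q where "q = d div 5"
  have fin: "finite (Pow D)" using assms by simp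
  \<comment> \<open>The weight 1/4 is \<open>p / (1 - p)\<close> for the density
    \<open>p = 1/5\<close>, the optimal choice here.\<close>
  have "(\<Sum>Y\<in>Pow D. (1/4::real) ^ card Y) = (\<Prod>x\<in>D. 1/4 + 1)"
    using prod_add[OF assms, of "\<lambda>_. 1/4::real" "\<lambda>_. 1"] by simp
  also have "\<dots> = (5/4) ^ d" by (simp add: d_def)
  finally have total: "(\<Sum>Y\<in>Pow D. (1/4::real) ^ card Y) = (5/4) ^ d" .
  have "real (card B) * (1/4) ^ q = (\<Sum>Y\<in>B. (1/4::real) ^ q)" by simp
  also have "\<dots> \<le> (\<Sum>Y\<in>B. (1/4::real) ^ card Y)"
    by (intro sum_mono power_decreasing) (auto simp: B_def q_def)
  also have "\<dots> \<le> (\<Sum>Y\<in>Pow D. (1/4::real) ^ card Y)"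
    by (intro sum_mono2 fin) (auto simp: B_def)
  finally have "real (card B) * (1/4) ^ q \<le> (5/4) ^ d" using total by simp
  then have "real (card B) \<le> (5/4) ^ d * 4 ^ q" by (simp add: field_simps)
  then have "real (card B) ^ 5 \<le> ((5/4) ^ d * 4 ^ q) ^ 5" by (intro power_mono) auto
  also have "\<dots> = ((5/4) ^ 5) ^ d * 4 ^ (5 * q)"
    by (simp add: power_mult_distrib power_mult [symmetric] mult.commute)
  \<comment> \<open>Uses \<open>(5/4) ^ 5 = 3125/1024 \<le> 4\<close> and
    \<open>5 * q \<le> d\<close>.\<close>
  also have "\<dots> \<le> 4 ^ d * 4 ^ d"
    by (intro mult_mono power_mono power_increasing) (auto simp: q_def power_divide)
  also have "\<dots> = real (16 ^ d)" by (simp flip: power_mult_distrib)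
  finally have "real (card B ^ 5) \<le> real (16 ^ d)" by simp
  then have "card B ^ 5 \<le> 16 ^ d" by (simp only: of_nat_le_iff)
  then show ?thesis by (simp add: B_def d_def)
qed

text \<open>The averaging argument that fixes the sender's coins. Finite support turns the
  expectation into a finite sum.\<close>

lemma pmf_expectation_attained:
  fixes f :: "'a \<Rightarrow> real"
  assumes "finite (set_pmf M)" and "c \<le> measure_pmf.expectation M f"
  shows "\<exists>m\<in>set_pmf M. c \<le> f m"
proof (rule ccontr)
  assume "\<not> ?thesis"
  then have less: "f m < c" if "m \<in> set_pmf M" for m using that by force
  have "measure_pmf.expectation M f = (\<Sum>m\<in>set_pmf M. f m * pmf M m)"
    by (rule integral_measure_pmf_real[OF assms(1)]) auto
  also have "\<dots> < (\<Sum>m\<in>set_pmf M. c * pmf M m)"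
    using less by (intro sum_strict_mono assms(1) set_pmf_not_empty mult_strict_right_mono)
      (auto simp: pmf_positive)
  also have "\<dots> = c" by (simp add: sum_distrib_left [symmetric] sum_pmf_eq_1 assms(1))
  finally show False using assms(2) by simp
qed

text \<open>\<open>s i b m\<close> is the probability that the receiver, holding message \<open>m\<close> and index \<open>i\<close>,
  announces the bit \<open>b\<close>. Averaging over the sender's coins, each \<open>X\<close> has a single message for
  which these probabilities of the correct bits sum to at least \<open>9d/10\<close>; rounding them at \<open>1/2\<close>
  then recovers \<open>X\<close> up to \<open>d/5\<close> errors, so a message serves at most a Hamming ball of sets.\<close>

lemma index_one_way_lower_bound:
  fixes M :: "nat set \<Rightarrow> 'm pmf" and s :: "nat \<Rightarrow> bool \<Rightarrow> 'm \<Rightarrow> real"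
  assumes fin: "finite Ms"
    and supp: "\<And>X. X \<subseteq> {..<d} \<Longrightarrow> set_pmf (M X) \<subseteq> Ms"
    and nonneg: "\<And>i b m. 0 \<le> s i b m"
    and excl: "\<And>i m. s i True m + s i False m \<le> 1"
    and succ: "\<And>X i. X \<subseteq> {..<d} \<Longrightarrow> i < d \<Longrightarrow>
      9 / 10 \<le> measure_pmf.expectation (M X) (s i (i \<in> X))"
  shows "2 ^ d \<le> card Ms ^ 5"
proof -
  \<comment> \<open>The set read off from message \<open>m\<close>; a tie at 1/2 counts as
    \<open>i\<close> being absent.\<close>
  define T where "T m = {i. i < d \<and> 1 / 2 < s i True m}" for m
  define B where "B = {Y \<in> Pow {..<d}. 5 * card Y \<le> d}"
  have finB: "finite B" by (simp add: B_def)
  have "\<exists>m\<in>Ms. sym_diff X (T m) \<in> B" if X: "X \<subseteq> {..<d}" for X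
  proof -
    have finM: "finite (set_pmf (M X))" using supp[OF X] fin finite_subset by blast
    have "9 / 10 * real d = (\<Sum>i<d. 9 / 10)" by simp
    also have "\<dots> \<le> (\<Sum>i<d. measure_pmf.expectation (M X) (s i (i \<in> X)))"
      by (intro sum_mono succ X) simp
    also have "\<dots> = measure_pmf.expectation (M X) (\<lambda>m. \<Sum>i<d. s i (i \<in> X) m)"
      by (intro Bochner_Integration.integral_sum [symmetric] integrable_measure_pmf_finite finM)
    finally obtain m where m: "m \<in> set_pmf (M X)"
      and large: "9 / 10 * real d \<le> (\<Sum>i<d. s i (i \<in> X) m)"
      using pmf_expectation_attained[OF finM] by blast
    define W where "W = sym_diff X (T m)"
    have W: "W \<subseteq> {..<d}" using X by (auto simp: W_def T_def)
    \<comment> \<open>A wrongly rounded bit has success probability at most 1/2; when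
      \<open>i\<close> is wrongly included, this is where \<open>excl\<close> enters.\<close>
    have "s i (i \<in> X) m \<le> 1 - (if i \<in> W then 1 / 2 else 0)" if "i < d" for i
      using excl[of i m] nonneg[of i True m] nonneg[of i False m] that
      by (cases "i \<in> X") (auto simp: W_def T_def)
    then have "(\<Sum>i<d. s i (i \<in> X) m) \<le> (\<Sum>i<d. 1 - (if i \<in> W then 1 / 2 else 0))"
      by (intro sum_mono) auto
    also have "\<dots> = real d - real (card W) / 2"
      using W by (simp add: sum_subtractf sum.If_cases Int_absorb1)
    finally have "5 * card W \<le> d" using large by linarith
    then show ?thesis using m supp[OF X] W by (auto simp: B_def W_def)
  qed
  \<comment> \<open>Symmetric difference with \<open>T m\<close> is an involution, so the message
    and the error set determine \<open>X\<close>.\<close>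
  then have "Pow {..<d} \<subseteq> (\<lambda>(m, Y). sym_diff Y (T m)) ` (Ms \<times> B)"
  proof (intro subsetI)
    fix X assume ex: "\<And>X. X \<subseteq> {..<d} \<Longrightarrow> \<exists>m\<in>Ms. sym_diff X (T m) \<in> B"
      and "X \<in> Pow {..<d}"
    then obtain m where "m \<in> Ms" "sym_diff X (T m) \<in> B" by blast
    moreover have "X = sym_diff (sym_diff X (T m)) (T m)" by blast
    ultimately show "X \<in> (\<lambda>(m, Y). sym_diff Y (T m)) ` (Ms \<times> B)"
      by (intro image_eqI[of _ _ "(m, sym_diff X (T m))"]) (simp, blast)
  qed
  then have "card (Pow {..<d}) \<le> card (Ms \<times> B)"
    by (rule surj_card_le[rotated]) (use fin finB in simp)
  then have "2 ^ d \<le> card Ms * card B" by (simp add: card_Pow card_cartesian_product)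
  \<comment> \<open>After taking fifth powers, the left side is \<open>2 ^ d * 16 ^ d\<close>, and
    the factor \<open>16 ^ d\<close> cancels against the bound on \<open>card B ^ 5\<close>.\<close>
  then have "(2 ^ d) ^ 5 \<le> (card Ms * card B) ^ 5" by (rule power_mono) simp
  also have "\<dots> \<le> card Ms ^ 5 * 16 ^ d"
    using small_subsets_card_power5[of "{..<d}"] by (simp add: power_mult_distrib B_def)
  also have "(2 ^ d) ^ 5 = (2 ^ d * 16 ^ d :: nat)"
    by (simp add: power_mult [symmetric] mult.commute[of d] flip: power_mult_distrib)
       (simp add: power_mult)
  finally show ?thesis by simp
qed

section \<open>Relabelling graphs\<close>

definition map_graph :: "('a \<Rightarrow> 'b) \<Rightarrow> 'a graph \<Rightarrow> 'b graph" where
  "map_graph f G = \<lparr>verts = f ` verts G, edges = (`) f ` edges G\<rparr>"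

lemma simple_graph_map_graph:
  assumes "simple_graph G" and "inj_on f (verts G)"
  shows "simple_graph (map_graph f G)"
proof -
  have "card (f ` e) = 2" if "e \<in> edges G" for e
    using assms that card_image[OF inj_on_subset[OF assms(2)], of e]
    by (auto simp: simple_graph_def)
  then show ?thesis using assms by (auto simp: simple_graph_def map_graph_def)
qed

text \<open>The isomorphism is \<open>g\<close> after the inverse of \<open>f\<close>. Later
  \<open>f\<close> names vertices by numbers, while \<open>g\<close> moves the graph inside the
  heavy edges graph.\<close>

lemma isomorphic_map_graph:
  assumes "simple_graph G" and f: "inj_on f (verts G)" and g: "inj_on g (verts G)"
  shows "isomorphic (map_graph f G) (map_graph g G)"
proof -
  define h where "h = g \<circ> inv_into (verts G) f"
  have hf: "h (f x) = g x" if "x \<in> verts G" for x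
    using that f by (simp add: h_def)
  have "bij_betw h (f ` verts G) (g ` verts G)"
    unfolding h_def using f g
    by (intro bij_betw_trans[where B = "verts G"] bij_betw_inv_into) (auto simp: bij_betw_def)
  moreover have "h ` f ` e = g ` e" if "e \<in> edges G" for e
  proof -
    have "e \<subseteq> verts G" using that assms(1) by (auto simp: simple_graph_def)
    then show ?thesis using hf by (force simp: image_image intro!: image_cong)
  qed
  then have "(`) g ` edges G = (`) h ` (`) f ` edges G"
    by (auto simp: image_image intro!: image_cong)
  ultimately have "\<exists>h. bij_betw h (verts (map_graph f G)) (verts (map_graph g G)) \<and>
      edges (map_graph g G) = (`) h ` edges (map_graph f G)"
    by (auto simp: map_graph_def)
  then show ?thesis
    using simple_graph_map_graph[OF assms(1) f] simple_graph_map_graph[OF assms(1) g]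
    by (simp add: isomorphic_def)
qed

text \<open>Taking images under \<open>f\<close> is injective on subsets of \<open>verts G\<close>,
  so edges are reflected as well as preserved and triangles correspond one to one.\<close>

lemma num_triangles_map_graph:
  assumes "simple_graph G" and f: "inj_on f (verts G)"
  shows "num_triangles (map_graph f G) = num_triangles G"
proof -
  have edge: "{f x, f y} \<in> (`) f ` edges G \<longleftrightarrow> {x, y} \<in> edges G"
    if "x \<in> verts G" "y \<in> verts G" for x y
  proof
    assume "{f x, f y} \<in> (`) f ` edges G"
    then obtain e where e: "e \<in> edges G" "f ` {x, y} = f ` e" by auto
    then have "{x, y} = e"
      using inj_on_image_eq_iff[OF f, of "{x, y}" e] assms(1) that
      by (auto simp: simple_graph_def)
    then show "{x, y} \<in> edges G" using e by simp
  next
    assume "{x, y} \<in> edges G"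
    then show "{f x, f y} \<in> (`) f ` edges G" by (force intro: image_eqI[of _ _ "{x, y}"])
  qed
  have "triangles (map_graph f G) = (`) f ` triangles G"
  proof (intro equalityI subsetI)
    fix t assume t: "t \<in> triangles (map_graph f G)"
    then have sub: "t \<subseteq> f ` verts G" by (auto simp: triangles_def map_graph_def)
    then obtain s where s: "s \<subseteq> verts G" "t = f ` s" by (auto simp: subset_image_iff)
    have inj: "inj_on f s" using f s inj_on_subset by blast
    have "{x, y} \<in> edges G" if "x \<in> s" "y \<in> s" "x \<noteq> y" for x y
    proof -
      have "f x \<noteq> f y" using inj that by (auto dest: inj_onD)
      then have "{f x, f y} \<in> (`) f ` edges G"
        using t that s by (auto simp: triangles_def map_graph_def)
      then show ?thesis using edge that s by auto
    qed
    moreover have "card s = 3" using t s card_image[OF inj] by (auto simp: triangles_def)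
    ultimately have "s \<in> triangles G" using s by (auto simp: triangles_def)
    then show "t \<in> (`) f ` triangles G" using s by auto
  next
    fix t assume "t \<in> (`) f ` triangles G"
    then obtain s where s: "s \<in> triangles G" "t = f ` s" by auto
    then have sub: "s \<subseteq> verts G" by (auto simp: triangles_def)
    have "card t = 3"
      using s card_image[OF inj_on_subset[OF f sub]] by (auto simp: triangles_def)
    moreover have "{x, y} \<in> (`) f ` edges G" if xy: "x \<in> t" "y \<in> t" "x \<noteq> y" for x y
    proof -
      obtain a b where ab: "a \<in> s" "b \<in> s" "x = f a" "y = f b" using xy s by auto
      then have "{a, b} \<in> edges G" using s xy by (auto simp: triangles_def)
      then show ?thesis using edge ab sub by auto
    qed
    ultimately show "t \<in> triangles (map_graph f G)"
      using s sub by (auto simp: triangles_def map_graph_def)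
  qed
  moreover have "inj_on ((`) f) (triangles G)"
    by (rule inj_on_subset[OF inj_on_image_Pow[OF f]]) (auto simp: triangles_def)
  ultimately show ?thesis by (simp add: num_triangles_def card_image)
qed

section \<open>The hard instances\<close>

text \<open>The sender's half of the input, independent of the index \<open>i\<close>.\<close>

definition index_matching :: "nat \<Rightarrow> nat set \<Rightarrow> (nat \<times> heavy_vertex) set set" where
  "index_matching r X = {{(k, U (2 * j)), (k, U (2 * j + 1))} | k j. k < r \<and> j \<in> X}"

text \<open>The receiver's half, independent of \<open>X\<close>; \<open>a\<close> selects an
  endpoint of the pair.\<close>

definition index_spokes :: "nat \<Rightarrow> nat \<Rightarrow> nat \<Rightarrow> (nat \<times> heavy_vertex) set set" where
  "index_spokes r d i = {{(k, U (2 * i + a)), (k, V j)} | k a j. k < r \<and> a \<in> {0, 1} \<and> j < d}"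

text \<open>The vertex set is the same for all \<open>X\<close> and \<open>i\<close>, possibly with
  isolated vertices, so one naming of the vertices serves every instance.\<close>

definition index_graph :: "nat \<Rightarrow> nat \<Rightarrow> nat set \<Rightarrow> nat \<Rightarrow> (nat \<times> heavy_vertex) graph" where
  "index_graph r d X i =
     \<lparr>verts = verts (heavy_edges_graph r d),
      edges = index_matching r X \<union> index_spokes r d i\<rparr>"

text \<open>Lets the adjacency and triangle results for hard instances apply to the host graph
  too.\<close>

lemma heavy_edges_graph_eq_index_graph:
  "heavy_edges_graph r d = index_graph r d {..<d} 0"
  by (simp add: heavy_edges_graph_def index_graph_def index_matching_def index_spokes_def)

lemma verts_heavy_edges_graph:
  "verts (heavy_edges_graph r d) = {..<r} \<times> (U ` {..<2 * d} \<union> V ` {..<d})"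
  by (auto simp: heavy_edges_graph_def)

lemma simple_graph_index_graph:
  assumes "X \<subseteq> {..<d}" and "i < d"
  shows "simple_graph (index_graph r d X i)"
proof -
  have "2 * j + 1 < 2 * d" if "j < d" for j using that by simp
  then show ?thesis using assms
    by (fastforce simp: simple_graph_def index_graph_def index_matching_def index_spokes_def
        verts_heavy_edges_graph)
qed

text \<open>Ensures that the concatenated halves of the stream repeat no edge.\<close>

lemma index_matching_spokes_disjoint: "index_matching r X \<inter> index_spokes r d i = {}"
  by (auto simp: index_matching_def index_spokes_def doubleton_eq_iff)

section \<open>Adjacency and triangles in the hard instances\<close>

lemma div2_eq_iff: "m div 2 = i \<longleftrightarrow> m = 2 * i \<or> m = 2 * i + 1" for m i :: nat
  by linarith

lemma index_graph_edge_UU: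
  "{(k, U m), (l, U n)} \<in> edges (index_graph r d X i) \<longleftrightarrow>
     k = l \<and> k < r \<and> m div 2 = n div 2 \<and> m \<noteq> n \<and> m div 2 \<in> X"
proof
  assume "k = l \<and> k < r \<and> m div 2 = n div 2 \<and> m \<noteq> n \<and> m div 2 \<in> X"
  moreover from this have "m = 2 * (m div 2) \<and> n = 2 * (m div 2) + 1 \<or>
      n = 2 * (m div 2) \<and> m = 2 * (m div 2) + 1"
    using div2_eq_iff[of m "m div 2"] div2_eq_iff[of n "m div 2"] by fastforce
  ultimately have "\<exists>j. {(k, U m), (l, U n)} = {(k, U (2 * j)), (k, U (2 * j + 1))} \<and> k < r \<and> j \<in> X"
    by (intro exI[of _ "m div 2"]) (elim conjE disjE; simp add: insert_commute)
  then show "{(k, U m), (l, U n)} \<in> edges (index_graph r d X i)"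
    unfolding index_graph_def index_matching_def by auto
qed (auto simp: index_graph_def index_matching_def index_spokes_def doubleton_eq_iff)

lemma index_graph_edge_UV:
  "{(k, U m), (l, V j)} \<in> edges (index_graph r d X i) \<longleftrightarrow>
     k = l \<and> k < r \<and> m div 2 = i \<and> j < d"
proof
  assume "k = l \<and> k < r \<and> m div 2 = i \<and> j < d"
  moreover from this have "m = 2 * i + m mod 2" "m mod 2 \<in> {0, 1}" by auto
  ultimately have "{(k, U m), (l, V j)} \<in> index_spokes r d i"
    unfolding index_spokes_def mem_Collect_eq
    by (intro exI[of _ k] exI[of _ "m mod 2"] exI[of _ j]) simp
  then show "{(k, U m), (l, V j)} \<in> edges (index_graph r d X i)"
    by (simp add: index_graph_def)
qed (auto simp: index_graph_def index_matching_def index_spokes_def doubleton_eq_iff)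

lemma index_graph_edge_VU:
  "{(l, V j), (k, U m)} \<in> edges (index_graph r d X i) \<longleftrightarrow>
     k = l \<and> k < r \<and> m div 2 = i \<and> j < d"
  using index_graph_edge_UV by (simp add: insert_commute)

lemma index_graph_edge_VV: "{(k, V m), (l, V n)} \<notin> edges (index_graph r d X i)"
  by (auto simp: index_graph_def index_matching_def index_spokes_def doubleton_eq_iff)

lemmas index_graph_edge =
  index_graph_edge_UU index_graph_edge_UV index_graph_edge_VU index_graph_edge_VV

text \<open>No two \<open>V\<close> vertices are adjacent, and adjacent \<open>U\<close> vertices
  share their half, which only two numbers can do. So a triangle has exactly one \<open>V\<close>
  vertex, whose neighbours form pair \<open>i\<close>, and that pair is an edge only if
  \<open>i \<in> X\<close>.\<close>

lemma triangles_index_graph: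
  assumes "i < d"
  shows "triangles (index_graph r d X i) =
    (if i \<in> X then (\<lambda>(k, j). {(k, U (2 * i)), (k, U (2 * i + 1)), (k, V j)}) ` ({..<r} \<times> {..<d})
     else {})"
    (is "_ = (if _ then ?f ` _ else _)")
proof -
  have UU: "m = 2 * i \<and> n = 2 * i + 1 \<or> n = 2 * i \<and> m = 2 * i + 1"
    if "m div 2 = i" "n div 2 = i" "m \<noteq> n" for m n :: nat
    using that unfolding div2_eq_iff by blast
  have UUU: False if "m div 2 = n div 2" "n div 2 = p div 2" "m \<noteq> n" "n \<noteq> p" "m \<noteq> p"
    for m n p :: nat
    using that div2_eq_iff[of m "p div 2"] div2_eq_iff[of n "p div 2"] div2_eq_iff[of p "p div 2"]
    by metis
  have "i \<in> X \<and> t \<in> ?f ` ({..<r} \<times> {..<d})"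
    if t: "t \<in> triangles (index_graph r d X i)" for t
  proof -
    let ?E = "edges (index_graph r d X i)"
    obtain a b c where abc: "t = {a, b, c}" "a \<noteq> b" "b \<noteq> c" "a \<noteq> c"
      using t by (auto simp: triangles_def card_3_iff)
    have e: "{a, b} \<in> ?E" "{b, c} \<in> ?E" "{a, c} \<in> ?E"
      using t abc by (auto simp: triangles_def)
    \<comment> \<open>The case with the \<open>V\<close> vertex last; the other positions reduce to
      it by permuting the three vertices.\<close>
    have UUV: "i \<in> X \<and> {(k, U m), (l, U n), (p, V j)} \<in> ?f ` ({..<r} \<times> {..<d})"
      if "{(k, U m), (l, U n)} \<in> ?E" "{(l, U n), (p, V j)} \<in> ?E" for k l p m n j
    proof -
      have h: "k = l" "l = p" "p < r" "j < d" "m div 2 = i" "n div 2 = i" "m \<noteq> n" "i \<in> X"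
        using that by (auto simp: index_graph_edge)
      then have "{(k, U m), (l, U n), (p, V j)} = ?f (p, j)" using UU[of m n] by auto
      then show ?thesis using h by (intro conjI image_eqI[of _ _ "(p, j)"]) auto
    qed
    obtain k l p a' b' c' where v: "a = (k, a')" "b = (l, b')" "c = (p, c')" by (metis surj_pair)
    show ?thesis
    proof (cases a')
      case aU: (U m)
      show ?thesis
      proof (cases b')
        case bU: (U n)
        show ?thesis
        proof (cases c')
          case (U q)
          then show ?thesis using e v aU bU UUU[of m n q] by (auto simp: index_graph_edge)
        next
          case (V q)
          then show ?thesis using UUV e v aU bU abc by auto
        qed
      next
        case bV: (V n)
        show ?thesis
        proof (cases c')
          case (U q)
          then show ?thesis using UUV[of k m p q l n] e v aU bV abc by (auto simp: insert_commute)
        next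
          case (V q)
          then show ?thesis using e v bV by (auto simp: index_graph_edge)
        qed
      qed
    next
      case aV: (V m)
      show ?thesis
      proof (cases b')
        case bU: (U n)
        show ?thesis
        proof (cases c')
          case (U q)
          then show ?thesis using UUV[of l n p q k m] e v aV bU abc by (auto simp: insert_commute)
        next
          case (V q)
          then show ?thesis using e v aV by (auto simp: index_graph_edge)
        qed
      next
        case (V n)
        then show ?thesis using e v aV by (auto simp: index_graph_edge)
      qed
    qed
  qed
  moreover have "?f (k, j) \<in> triangles (index_graph r d X i)" if "i \<in> X" "k < r" "j < d" for k j
  proof -
    have "2 * i + 1 < 2 * d" using assms by simp
    then have "?f (k, j) \<subseteq> verts (index_graph r d X i)"
      using that assms by (auto simp: index_graph_def verts_heavy_edges_graph)
    then show ?thesis using that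
      by (auto simp: triangles_def index_graph_edge)
  qed
  ultimately have "i \<in> X \<Longrightarrow> triangles (index_graph r d X i) = ?f ` ({..<r} \<times> {..<d})"
    and "i \<notin> X \<Longrightarrow> triangles (index_graph r d X i) = {}" by blast+
  then show ?thesis by simp
qed

lemma num_triangles_index_graph:
  assumes "i < d"
  shows "num_triangles (index_graph r d X i) = (if i \<in> X then r * d else 0)"
proof -
  have "inj_on (\<lambda>(k, j). {(k, U (2 * i)), (k, U (2 * i + 1)), (k, V j)}) ({..<r} \<times> {..<d})"
    by (auto simp: inj_on_def)
  then show ?thesis
    by (simp add: num_triangles_def triangles_index_graph[OF assms] card_image
        card_cartesian_product)
qed

section \<open>Embedding the hard instances into the heavy edges graph\<close>

definition heavy_edge_swap :: "nat \<Rightarrow> nat \<times> heavy_vertex \<Rightarrow> nat \<times> heavy_vertex" where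
  "heavy_edge_swap i v = (case v of
     (k, U n) \<Rightarrow> (k, U (2 * Transposition.transpose 0 i (n div 2) + n mod 2))
   | (k, V j) \<Rightarrow> (k, V j))"

lemma heavy_edge_swap_involutive [simp]: "heavy_edge_swap i (heavy_edge_swap i v) = v"
  by (auto simp: heavy_edge_swap_def split: prod.splits heavy_vertex.splits)

lemma inj_heavy_edge_swap: "inj (heavy_edge_swap i)"
  by (metis heavy_edge_swap_involutive injI)

text \<open>The swap exchanges pairs 0 and \<open>i\<close> in each copy, respecting parity within a
  pair. It moves the spokes to pair 0, where the host has them, and permutes the matching edges of
  the host.\<close>

lemma subgraph_swap_index_graph:
  assumes X: "X \<subseteq> {..<d}" and i: "i < d"
  shows "subgraph (map_graph (heavy_edge_swap i) (index_graph r d X i)) (heavy_edges_graph r d)"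
proof -
  have tr: "Transposition.transpose 0 i j < d" if "j < d" for j
    using that i by (auto simp: Transposition.transpose_def)
  have bound: "2 * Transposition.transpose 0 i (n div 2) + n mod 2 < 2 * d" if "n < 2 * d" for n
  proof -
    have "n div 2 < d" using that by simp
    from tr[OF this] show ?thesis by presburger
  qed
  have "heavy_edge_swap i ` verts (heavy_edges_graph r d) \<subseteq> verts (heavy_edges_graph r d)"
    using bound by (auto simp: verts_heavy_edges_graph heavy_edge_swap_def)
  moreover have "(`) (heavy_edge_swap i) ` (index_matching r X \<union> index_spokes r d i)
    \<subseteq> edges (heavy_edges_graph r d)"
  proof -
    have "heavy_edge_swap i ` e \<in> edges (index_graph r d {..<d} 0)"
      if e: "e \<in> index_matching r X" for e
    proof -
      obtain k j where kj: "e = {(k, U (2 * j)), (k, U (2 * j + 1))}" "k < r" "j \<in> X"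
        using e unfolding index_matching_def by blast
      define j' where "j' = Transposition.transpose 0 i j"
      have "heavy_edge_swap i ` e = {(k, U (2 * j')), (k, U (2 * j' + 1))}"
        by (simp add: kj(1) heavy_edge_swap_def j'_def)
      moreover have "j' < d" using kj X tr by (auto simp: j'_def)
      ultimately show ?thesis using kj by (simp add: index_graph_edge)
    qed
    moreover have "heavy_edge_swap i ` e \<in> edges (index_graph r d {..<d} 0)"
      if e: "e \<in> index_spokes r d i" for e
    proof -
      obtain k a j where kaj: "e = {(k, U (2 * i + a)), (k, V j)}" "k < r" "a \<in> {0, 1}" "j < d"
        using e unfolding index_spokes_def by blast
      then have "heavy_edge_swap i ` e = {(k, U a), (k, V j)}"
        by (auto simp: heavy_edge_swap_def)
      then show ?thesis using kaj by (auto simp: index_graph_edge)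
    qed
    ultimately show ?thesis by (auto simp: heavy_edges_graph_eq_index_graph)
  qed
  moreover have "simple_graph (heavy_edges_graph r d)"
    using simple_graph_index_graph[of "{..<d}" d 0 r] i
    by (simp add: heavy_edges_graph_eq_index_graph)
  moreover have "simple_graph (map_graph (heavy_edge_swap i) (index_graph r d X i))"
    using simple_graph_index_graph[OF assms] inj_on_subset[OF inj_heavy_edge_swap]
    by (intro simple_graph_map_graph) auto
  ultimately show ?thesis by (simp add: subgraph_def map_graph_def index_graph_def)
qed

section \<open>Streaming algorithms\<close>

text \<open>The Markov property: a run depends on the past only through the current memory
  state.\<close>

lemma foldl_bind_pmf:
  "foldl (\<lambda>M e. bind_pmf M (f e)) M xs =
     bind_pmf M (\<lambda>m. foldl (\<lambda>M e. bind_pmf M (f e)) (return_pmf m) xs)"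
proof (induction xs arbitrary: M)
  case Nil
  show ?case by (simp add: bind_return_pmf')
next
  case (Cons x xs)
  show ?case
    using Cons[of "bind_pmf M (f x)"] Cons[of "f x m" for m]
    by (simp add: bind_return_pmf bind_assoc_pmf)
qed

text \<open>The receiver's computation: \<open>m\<close> is the message and \<open>ys\<close> the
  receiver's half of the stream.\<close>

definition output_from :: "stream_alg \<Rightarrow> bool list \<Rightarrow> nat set list \<Rightarrow> real pmf" where
  "output_from A m ys =
     bind_pmf (foldl (\<lambda>M e. bind_pmf M (update A e)) (return_pmf m) ys) (result A)"

lemma alg_output_append:
  "alg_output A (xs @ ys) = bind_pmf (memory_after A xs) (\<lambda>m. output_from A m ys)"
  unfolding alg_output_def memory_after_def output_from_def foldl_append
  using foldl_bind_pmf[of "update A" "foldl (\<lambda>M e. bind_pmf M (update A e)) (init A) xs" ys]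
  by (simp add: bind_assoc_pmf)

lemma prob_bind_pmf:
  "measure_pmf.prob (bind_pmf M f) A = measure_pmf.expectation M (\<lambda>m. measure_pmf.prob (f m) A)"
proof -
  have "measure_pmf (bind_pmf M f) = measure_pmf M \<bind> (\<lambda>x. measure_pmf (f x))"
    by (rule measure_pmf_bind)
  then show ?thesis
    by (simp add: measure_pmf.measure_bind[where N = "count_space UNIV"]
        measure_pmf_in_subprob_algebra)
qed

text \<open>An algorithm that stores only edges does not know the vertex set; this is harmless
  because every vertex of a triangle lies on an edge.\<close>

lemma num_triangles_UNIV:
  assumes "simple_graph G"
  shows "num_triangles \<lparr>verts = UNIV, edges = edges G\<rparr> = num_triangles G"
proof -
  have "t \<subseteq> verts G"
    if "card t = 3" "\<forall>x\<in>t. \<forall>y\<in>t. x \<noteq> y \<longrightarrow> {x, y} \<in> edges G" for t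
  proof
    fix x assume x: "x \<in> t"
    then obtain y where "y \<in> t" "y \<noteq> x" using \<open>card t = 3\<close> by (auto simp: card_3_iff)
    then have "{x, y} \<in> edges G" using that x by auto
    then show "x \<in> verts G" using assms by (auto simp: simple_graph_def)
  qed
  then have "triangles \<lparr>verts = UNIV, edges = edges G\<rparr> = triangles G"
    by (auto simp: triangles_def)
  then show ?thesis by (simp add: num_triangles_def)
qed

text \<open>Storing the whole input solves the problem, so the \<open>LEAST\<close> in \<^const>\<open>instopt\<close> is attained.\<close>

lemma exists_solving_algorithm:
  assumes "0 \<le> \<epsilon>" and "0 \<le> \<delta>"
  shows "\<exists>S A. solves A N G S \<epsilon> \<delta>"
proof -
  let ?P = "Pow (Pow {..<N})"
  have "finite ?P" by simp
  then obtain h :: "nat set set \<Rightarrow> nat" and n where h: "h ` ?P = {i. i < n}" "inj_on h ?P"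
    using finite_imp_inj_to_nat_seg[of ?P] by auto
  \<comment> \<open>A unary code, decoded by its length, is enough: only some finite space bound is
    wanted.\<close>
  define enc where "enc E = replicate (h E) True" for E
  define dec where "dec m = inv_into ?P h (length m)" for m :: "bool list"
  have dec: "dec (enc E) = E" if "E \<in> ?P" for E using that h(2) by (simp add: dec_def enc_def)
  define A where "A = \<lparr>init = return_pmf (enc {}),
    update = (\<lambda>e m. return_pmf (enc (insert e (dec m)))),
    result = (\<lambda>m. return_pmf (real (num_triangles \<lparr>verts = UNIV, edges = dec m\<rparr>)))\<rparr>"
  have mem: "memory_after A xs = return_pmf (enc (set xs))" if "set xs \<in> ?P" for xs
    using that
  proof (induction xs rule: rev_induct)
    case Nil
    show ?case by (simp add: memory_after_def A_def)
  next
    case (snoc x xs)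
    then have "memory_after A xs = return_pmf (enc (set xs))" and "set xs \<in> ?P" by auto
    then show ?case
      by (simp add: memory_after_def A_def bind_return_pmf dec del: Pow_iff)
  qed
  have "solves A N G n \<epsilon> \<delta>"
    unfolding solves_def
  proof (intro allI impI)
    fix G' :: "nat graph" and xs
    assume G': "verts G' \<subseteq> {..<N} \<and> (\<exists>H. subgraph H G \<and> isomorphic G' H)"
      and xs: "insertion_stream G' xs"
    then have simple: "simple_graph G'" by (auto simp: isomorphic_def)
    then have E: "edges G' \<in> ?P" using G' by (fastforce simp: simple_graph_def)
    have set: "set xs = edges G'" using xs by (simp add: insertion_stream_def)
    have "uses_space A xs n"
      unfolding uses_space_def
    proof (intro allI impI ballI)
      fix k m assume m: "m \<in> set_pmf (memory_after A (take k xs))"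
      have "set (take k xs) \<in> ?P" using set E set_take_subset[of k xs] by blast
      then have "h (set (take k xs)) < n" and "m = enc (set (take k xs))"
        using m mem[of "take k xs"] h(1) by (blast, simp)
      then show "length m \<le> n" by (simp add: enc_def)
    qed
    moreover have "alg_output A xs = return_pmf (real (num_triangles G'))"
    proof -
      have "result A (enc (edges G')) = return_pmf (real (num_triangles G'))"
        using dec[OF E] num_triangles_UNIV[OF simple] by (simp add: A_def)
      then show ?thesis using mem[of xs] set E by (simp add: alg_output_def bind_return_pmf)
    qed
    ultimately show "uses_space A xs n \<and> 1 - \<delta> \<le> measure_pmf.prob (alg_output A xs)
        {y. \<bar>y - real (num_triangles G')\<bar> \<le> \<epsilon> * real (num_triangles G)}"
      using assms by (simp add: measure_return_pmf)
  qed
  then show ?thesis by blast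
qed

text \<open>The memory at the cut is a bit string of length at most \<open>S\<close>, so there are
  fewer than \<open>2 ^ (S + 1)\<close> messages. The INDEX bound then gives
  \<open>d \<le> 5 * (S + 1)\<close>, which is at most \<open>10 * S\<close> once \<open>S\<close>
  is positive.\<close>

lemma heavy_edges_space_lower_bound:
  assumes A: "solves A N (heavy_edges_graph r d) S \<epsilon> (1 / 10)"
    and \<epsilon>: "\<epsilon> \<le> 1 / 4" and r: "1 \<le> r" and d: "1 \<le> d"
    and N: "card (verts (heavy_edges_graph r d)) \<le> N"
  shows "real d / 10 \<le> real S"
proof -
  let ?V = "verts (heavy_edges_graph r d)"
  have "finite ?V" by (simp add: verts_heavy_edges_graph)
  then obtain \<phi> where \<phi>: "inj_on \<phi> ?V" "\<phi> ` ?V \<subseteq> {..<N}"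
    using card_le_inj[of ?V "{..<N}"] N by auto
  define G' where "G' X i = map_graph \<phi> (index_graph r d X i)" for X i
  have total: "num_triangles (heavy_edges_graph r d) = r * d"
    using num_triangles_index_graph[of 0 d r "{..<d}"] d
    by (simp add: heavy_edges_graph_eq_index_graph)
  have vi: "verts (index_graph r d X i) = ?V" for X i by (simp add: index_graph_def)
  have count: "num_triangles (G' X i) = (if i \<in> X then r * d else 0)"
    if "X \<subseteq> {..<d}" "i < d" for X i
    using num_triangles_map_graph[OF simple_graph_index_graph[OF that], of \<phi> r]
      num_triangles_index_graph[OF that(2), of r X] \<phi>(1) by (simp add: G'_def vi)
  have admissible: "verts (G' X i) \<subseteq> {..<N} \<and>
      (\<exists>H. subgraph H (heavy_edges_graph r d) \<and> isomorphic (G' X i) H)"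
    if "X \<subseteq> {..<d}" "i < d" for X i
  proof -
    \<comment> \<open>The swap occurs only in the witness for admissibility. The streamed graph is
      not swapped, since the sender's edges must not depend on \<open>i\<close>.\<close>
    have "isomorphic (G' X i) (map_graph (heavy_edge_swap i) (index_graph r d X i))"
      unfolding G'_def
      by (intro isomorphic_map_graph simple_graph_index_graph that)
        (use \<phi>(1) inj_on_subset[OF inj_heavy_edge_swap] in \<open>auto simp: vi\<close>)
    moreover have "verts (G' X i) \<subseteq> {..<N}"
      using \<phi>(2) by (simp add: G'_def map_graph_def vi)
    ultimately show ?thesis using subgraph_swap_index_graph[OF that] by blast
  qed
  have fin: "finite (edges (G' X i))" if "X \<subseteq> {..<d}" "i < d" for X i
  proof -
    have "simple_graph (G' X i)" using admissible[OF that] by (auto simp: isomorphic_def)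
    then have "edges (G' X i) \<subseteq> Pow (verts (G' X i))" "finite (verts (G' X i))"
      by (auto simp: simple_graph_def)
    then show ?thesis using finite_subset by auto
  qed
  have edges_G': "edges (G' X i) = (`) \<phi> ` index_matching r X \<union> (`) \<phi> ` index_spokes r d i" for X i
    by (auto simp: G'_def map_graph_def index_graph_def)
  \<comment> \<open>The order of the sender's edges is chosen from \<open>X\<close> alone; index 0
    only supplies finiteness.\<close>
  have ex_xs: "\<exists>xs. X \<subseteq> {..<d} \<longrightarrow> distinct xs \<and> set xs = (`) \<phi> ` index_matching r X" for X
    using finite_distinct_list[of "(`) \<phi> ` index_matching r X"] fin[of X 0] d
    unfolding edges_G' by auto
  then obtain xs where xs: "\<And>X. X \<subseteq> {..<d} \<Longrightarrow> distinct (xs X)"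
    "\<And>X. X \<subseteq> {..<d} \<Longrightarrow> set (xs X) = (`) \<phi> ` index_matching r X" by metis
  have "\<exists>ys. i < d \<longrightarrow> distinct ys \<and> set ys = (`) \<phi> ` index_spokes r d i" for i
    using finite_distinct_list[of "(`) \<phi> ` index_spokes r d i"] fin[of "{}" i]
    unfolding edges_G' by auto
  then obtain ys where ys: "\<And>i. i < d \<Longrightarrow> distinct (ys i)"
    "\<And>i. i < d \<Longrightarrow> set (ys i) = (`) \<phi> ` index_spokes r d i" by metis
  have stream: "insertion_stream (G' X i) (xs X @ ys i)" if "X \<subseteq> {..<d}" "i < d" for X i
  proof -
    have "edges (index_graph r d X i) \<subseteq> Pow ?V"
      using simple_graph_index_graph[OF that, of r] by (auto simp: simple_graph_def vi)
    then have "(`) \<phi> ` index_matching r X \<inter> (`) \<phi> ` index_spokes r d i =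
        (`) \<phi> ` (index_matching r X \<inter> index_spokes r d i)"
      by (intro inj_on_image_Int[OF inj_on_image_Pow[OF \<phi>(1)], symmetric])
        (auto simp: index_graph_def)
    then show ?thesis using xs ys that
      by (simp add: insertion_stream_def edges_G' index_matching_spokes_disjoint)
  qed
  \<comment> \<open>The estimates acceptable when the bit at the receiver's index is
    \<open>b\<close>.\<close>
  define good where "good b = {y. \<bar>y - (if b then real (r * d) else 0)\<bar> \<le> \<epsilon> * real (r * d)}" for b
  define s where "s i b m = measure_pmf.prob (output_from A m (ys i)) (good b)" for i b m
  have sol: "uses_space A (xs X @ ys i) S"
    "9 / 10 \<le> measure_pmf.prob (alg_output A (xs X @ ys i)) (good (i \<in> X))"
    if "X \<subseteq> {..<d}" "i < d" for X i
  proof -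
    have "uses_space A (xs X @ ys i) S \<and> 1 - 1 / 10 \<le> measure_pmf.prob
        (alg_output A (xs X @ ys i)) {y. \<bar>y - real (num_triangles (G' X i))\<bar>
          \<le> \<epsilon> * real (num_triangles (heavy_edges_graph r d))}"
      using A admissible[OF that] stream[OF that] unfolding solves_def by blast
    moreover have "good (i \<in> X) = {y. \<bar>y - real (num_triangles (G' X i))\<bar>
          \<le> \<epsilon> * real (num_triangles (heavy_edges_graph r d))}"
      by (simp add: good_def count[OF that] total)
    ultimately show "uses_space A (xs X @ ys i) S"
      "9 / 10 \<le> measure_pmf.prob (alg_output A (xs X @ ys i)) (good (i \<in> X))" by simp_all
  qed
  let ?Ms = "{m :: bool list. set m \<subseteq> UNIV \<and> length m \<le> S}"
  have "2 ^ d \<le> card ?Ms ^ 5"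
  proof (rule index_one_way_lower_bound[where M = "\<lambda>X. memory_after A (xs X)" and s = s])
    show "finite ?Ms" by (rule finite_lists_length_le) simp
    show "set_pmf (memory_after A (xs X)) \<subseteq> ?Ms" if "X \<subseteq> {..<d}" for X
    proof -
      \<comment> \<open>Space is bounded only along streams of admissible inputs, so the sender's
        prefix is completed with index 0, available because \<open>1 \<le> d\<close>.\<close>
      have "\<forall>m\<in>set_pmf (memory_after A (take (length (xs X)) (xs X @ ys 0))). length m \<le> S"
        using sol(1)[OF that, of 0] d unfolding uses_space_def length_append
        by (meson le_add1 less_le_trans zero_less_one)
      then show ?thesis by auto
    qed
    show "0 \<le> s i b m" for i b m by (simp add: s_def)
    show "s i True m + s i False m \<le> 1" for i m
    proof -
      have pos: "real (r * d) > 0" using r d by simp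
      have "good True \<inter> good False = {}"
      proof -
        have False if "\<bar>y - real (r * d)\<bar> \<le> \<epsilon> * real (r * d)" "\<bar>y\<bar> \<le> \<epsilon> * real (r * d)" for y
        proof -
          \<comment> \<open>Intervals of radius at most \<open>rd/4\<close> around 0 and
            \<open>rd\<close> are disjoint because \<open>rd\<close> is positive.\<close>
          have "\<epsilon> * real (r * d) \<le> 1 / 4 * real (r * d)" using \<epsilon> pos by (intro mult_right_mono) auto
          then show False using that pos by linarith
        qed
        then show ?thesis by (auto simp: good_def)
      qed
      then show ?thesis
        unfolding s_def
        by (subst measure_pmf.finite_measure_Union [symmetric]) auto
    qed
    show "9 / 10 \<le> measure_pmf.expectation (memory_after A (xs X)) (s i (i \<in> X))"
      if "X \<subseteq> {..<d}" "i < d" for X i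
      using sol(2)[OF that] unfolding alg_output_append prob_bind_pmf s_def .
  qed
  moreover have card: "card ?Ms = (\<Sum>i\<le>S. 2 ^ i)"
    by (subst card_lists_length_le) auto
  ultimately have bound: "2 ^ d \<le> (\<Sum>i\<le>S. 2 ^ i :: nat) ^ 5" by simp
  \<comment> \<open>With \<open>S = 0\<close> the empty string would be the only message, forcing
    \<open>2 ^ d \<le> 1\<close>. Positivity of \<open>S\<close> later absorbs the additive
    5.\<close>
  have "S \<noteq> 0"
  proof
    assume "S = 0"
    then have "(2::nat) ^ d \<le> 2 ^ 0" using bound by simp
    then show False using d by (simp only: power_increasing_iff)
  qed
  have "(\<Sum>i\<le>S. 2 ^ i :: nat) \<le> 2 ^ Suc S" by (induction S) auto
  then have "(\<Sum>i\<le>S. 2 ^ i :: nat) ^ 5 \<le> (2 ^ Suc S) ^ 5" by (rule power_mono) simp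
  with bound have "(2::nat) ^ d \<le> 2 ^ (Suc S * 5)" unfolding power_mult by linarith
  then have "d \<le> Suc S * 5" by (rule power_le_imp_le_exp[rotated]) simp
  with \<open>S \<noteq> 0\<close> have "d \<le> 10 * S" by simp
  then have "real d \<le> real (10 * S)" by (simp only: of_nat_le_iff)
  then show ?thesis by simp
qed

theorem mainTheorem5:
  shows "\<exists>\<epsilon>\<^sub>0>0. \<forall>\<epsilon>::real. 0 < \<epsilon> \<and> \<epsilon> \<le> \<epsilon>\<^sub>0 \<longrightarrow>
    (\<exists>c>0. \<forall>r d N :: nat. 1 \<le> r \<and> 1 \<le> d \<and> card (verts (heavy_edges_graph r d)) \<le> N \<longrightarrow>
       c * real d \<le> real (instopt N (heavy_edges_graph r d) \<epsilon> (1 / 10)))"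
proof (rule exI[of _ "1 / 4"], intro conjI allI impI)
  fix \<epsilon> :: real assume \<epsilon>: "0 < \<epsilon> \<and> \<epsilon> \<le> 1 / 4"
  show "\<exists>c>0. \<forall>r d N :: nat. 1 \<le> r \<and> 1 \<le> d \<and> card (verts (heavy_edges_graph r d)) \<le> N \<longrightarrow>
       c * real d \<le> real (instopt N (heavy_edges_graph r d) \<epsilon> (1 / 10))"
  proof (rule exI[of _ "1 / 10"], intro conjI allI impI)
    fix r d N :: nat
    assume h: "1 \<le> r \<and> 1 \<le> d \<and> card (verts (heavy_edges_graph r d)) \<le> N"
    obtain A where "solves A N (heavy_edges_graph r d)
        (instopt N (heavy_edges_graph r d) \<epsilon> (1 / 10)) \<epsilon> (1 / 10)"
      unfolding instopt_def using \<epsilon> LeastI_ex[OF exists_solving_algorithm[of \<epsilon> "1 / 10"]] by fastforce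
    then show "1 / 10 * real d \<le> real (instopt N (heavy_edges_graph r d) \<epsilon> (1 / 10))"
      using heavy_edges_space_lower_bound[of A N r d _ \<epsilon>] h \<epsilon> by simp
  qed simp
qed simp

end
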